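(* Let $q$ be a prime power, let $n$ be an even integer, and let $k,l$ be integers with $k,l\le q$. Then \[ \mathrm{La}^{*}_{q}(n,\{\mathrm{V}_{k},\Lambda_{l}\}) = \begin{bmatrix} n\\ n/2\end{bmatrix}_q, \] and the only maximum-size family of subspaces of an $n$-dimensional vector space $V$ over $\mathbb{F}_q$ containing neither $\mathrm{V}_k$ nor $\Lambda_l$ as an induced subposet is the set of all $n/2$-dimensional subspaces of $V$.
   Context: Subspaces are ordered by inclusion. A poset $P$ is an induced subposet of $Q$ if there is an injection $\phi:P\to Q$ with $x\le_P y\iff\phi(x)\le_Q\phi(y)$. $\mathrm{V}_k$ is the poset with elements $x_1,\dots,x_k,y$ where $x_1,\dots,x_k>y$ (no other relations), and $\Lambda_k$ is the same poset with all relations reversed. $\mathrm{La}^*_q(n,\mathcal{P})$ is the maximum size of a family of subspaces of an $n$-dimensional vector space over $\mathbb{F}_q$ containing no member of $\mathcal{P}$ as an induced subposet. $\begin{bmatrix} n\\ k\end{bmatrix}_q=\prod_{0\le i<k}\frac{q^{n-i}-1}{q^{k-i}-1}$.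
   Formalization: Uniqueness is not claimed when n = 2 and k = l = q, where it fails ({0}, V and q−1 lines form another maximum-size family); also k, l ≥ 1 is assumed, since for k = 0 the poset V_0 is a single point and the claim is false. *)

theory Defs
  imports Complex_Main "HOL-Number_Theory.Prime_Powers"
begin

(* A poset is given by its reflexive order relation r; its set of elements is Field r. *)

definition induced_subposet :: "'a rel \<Rightarrow> 'b rel \<Rightarrow> bool" where
  "induced_subposet P Q \<longleftrightarrow>
    (\<exists>\<phi>. inj_on \<phi> (Field P) \<and> \<phi> ` Field P \<subseteq> Field Q \<and>
         (\<forall>x\<in>Field P. \<forall>y\<in>Field P. (x, y) \<in> P \<longleftrightarrow> (\<phi> x, \<phi> y) \<in> Q))"

(* The element y is 0 and x_i is i, for 1 <= i <= k. *)

definition V_poset :: "nat \<Rightarrow> nat rel" where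
  "V_poset k = Id_on {0..k} \<union> {0} \<times> {1..k}"

definition Lambda_poset :: "nat \<Rightarrow> nat rel" where
  "Lambda_poset k = (V_poset k)\<inverse>"

definition inclusion_order :: "'a set set \<Rightarrow> 'a set rel" where
  "inclusion_order \<F> = {(S, T). S \<in> \<F> \<and> T \<in> \<F> \<and> S \<subseteq> T}"

definition subspaces :: "('a::field \<Rightarrow> 'b::ab_group_add \<Rightarrow> 'b) \<Rightarrow> 'b set set" where
  "subspaces scale = {S. module.subspace scale S}"

definition subspaces_of_dim :: "('a::field \<Rightarrow> 'b::ab_group_add \<Rightarrow> 'b) \<Rightarrow> nat \<Rightarrow> 'b set set" where
  "subspaces_of_dim scale d = {S \<in> subspaces scale. vector_space.dim scale S = d}"

definition induced_free_family ::
    "('a::field \<Rightarrow> 'b::ab_group_add \<Rightarrow> 'b) \<Rightarrow> 'c rel set \<Rightarrow> 'b set set \<Rightarrow> bool" where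
  "induced_free_family scale \<P> \<F> \<longleftrightarrow>
    \<F> \<subseteq> subspaces scale \<and> (\<forall>P\<in>\<P>. \<not> induced_subposet P (inclusion_order \<F>))"

(* La*_q(n, \<P>), where q is the order of the scalar field and n is the dimension of the
   vector space acted on by scale. The maximum is over a finite set when the space is finite,
   and over a nonempty one when no member of \<P> is the empty poset. *)

definition La_star :: "('a::field \<Rightarrow> 'b::ab_group_add \<Rightarrow> 'b) \<Rightarrow> 'c rel set \<Rightarrow> nat" where
  "La_star scale \<P> = Max (card ` {\<F>. induced_free_family scale \<P> \<F>})"

definition max_induced_free_family ::
    "('a::field \<Rightarrow> 'b::ab_group_add \<Rightarrow> 'b) \<Rightarrow> 'c rel set \<Rightarrow> 'b set set \<Rightarrow> bool" where
  "max_induced_free_family scale \<P> \<F> \<longleftrightarrow>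
    induced_free_family scale \<P> \<F> \<and> card \<F> = La_star scale \<P>"

definition gauss_binomial :: "nat \<Rightarrow> nat \<Rightarrow> nat \<Rightarrow> real" where
  "gauss_binomial q n k =
    (\<Prod>i<k. (real q ^ (n - i) - 1) / (real q ^ (k - i) - 1))"

end

theory Submission
  imports Defs
begin

text \<open>
  Write \<open>n = 2m\<close> and \<open>[d] = 1 + q + \<dots> + q^(d-1)\<close>. A subspace of dimension \<open>i < m\<close> has \<open>[n-i]\<close> upper covers, of
  which at most \<open>q - 1\<close> belong to a family without \<open>V\<^sub>k\<close>, and a subspace of dimension \<open>i + 1\<close> has
  \<open>[i+1]\<close> lower covers. Since \<open>[n-i] - (q-1) \<ge> 2[i+1]\<close>, pushing the part of the family below the middle
  level upwards yields at least twice as many new middle subspaces. Dually for the part above.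
  The two sets of new subspaces may overlap, but the factor 2 compensates for that. In the equality
  case with a family other than the middle level, some middle subspace outside the family lies below
  a member, and all its \<open>[m]\<close> hyperplanes are members; if \<open>m \<ge> 2\<close>, then \<open>[m] > q\<close> gives a \<open>\<Lambda>\<^sub>l\<close>.
\<close>

section \<open>Doubling shadows in graded posets\<close>

text \<open>Order and rank are kept abstract so that inclusion with dimension and reverse inclusion
  with codimension are both instances. The \<open>+ 1\<close> in \<open>card_upper\<close> avoids
  truncated subtraction: after discarding q - 1 upper covers, twice \<open>dn\<close> of the next
  rank remain.\<close>

locale doubling_poset =
  fixes X :: "'c set" and le :: "'c \<Rightarrow> 'c \<Rightarrow> bool" and rk :: "'c \<Rightarrow> nat"
    and dn :: "nat \<Rightarrow> nat" and m q :: nat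
  assumes finite_X: "finite X"
    and le_trans: "le A B \<Longrightarrow> le B C \<Longrightarrow> le A C"
    and graded: "\<lbrakk>A \<in> X; B \<in> X; le A B; rk A < rk B\<rbrakk>
      \<Longrightarrow> \<exists>C\<in>X. le A C \<and> le C B \<and> rk C = Suc (rk A)"
    and card_upper: "\<lbrakk>A \<in> X; rk A < m\<rbrakk>
      \<Longrightarrow> 2 * dn (Suc (rk A)) + q \<le> card {B\<in>X. rk B = Suc (rk A) \<and> le A B} + 1"
    and card_lower: "\<lbrakk>B \<in> X; rk B \<le> m\<rbrakk>
      \<Longrightarrow> card {A\<in>X. Suc (rk A) = rk B \<and> le A B} = dn (rk B)"
    and dn_pos: "0 < dn (Suc i)"
begin

text \<open>Double counting of the pairs A below B with A in \<open>S\<close> and B in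
  \<open>N\<close>: each A has at least \<open>2 * dn (Suc i) + (q - k)\<close> partners, each B at
  most \<open>dn (Suc i)\<close>. The surplus \<open>q - k\<close> gives the second claim. Equality
  makes every B attain its bound, which gives the third.\<close>

lemma level_shadow:
  assumes "S \<subseteq> X" and rk_S: "\<forall>A\<in>S. rk A = i" and "i < m" and "U \<subseteq> X" and "k \<le> q"
    and few: "\<forall>A\<in>S. card {B\<in>U. rk B = Suc i \<and> le A B} < k"
  defines "N \<equiv> {B\<in>X. rk B = Suc i \<and> B \<notin> U \<and> (\<exists>A\<in>S. le A B)}"
  shows "2 * card S \<le> card N"
    and "card N = 2 * card S \<Longrightarrow> S \<noteq> {} \<Longrightarrow> k = q"
    and "\<lbrakk>card N = 2 * card S; B \<in> N; A \<in> X; rk A = i; le A B\<rbrakk> \<Longrightarrow> A \<in> S"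
proof -
  have fin: "finite S" "finite N" "finite U"
    using finite_X assms(1,4) by (auto simp: N_def intro: finite_subset)
  have N_rk: "B \<in> X" "rk B = Suc i" if "B \<in> N" for B using that by (auto simp: N_def)
  \<comment> \<open>Of the at least 2 \<open>dn (Suc i)\<close> + q - 1 upper covers of A, at most k
    - 1 lie in \<open>U\<close>.\<close>
  have c: "2 * dn (Suc i) + (q - k) \<le> card {B\<in>N. le A B}" if "A \<in> S" for A
  proof -
    have "{B\<in>X. rk B = Suc i \<and> le A B} \<subseteq> {B\<in>N. le A B} \<union> {B\<in>U. rk B = Suc i \<and> le A B}"
      using that by (auto simp: N_def)
    then have "card {B\<in>X. rk B = Suc i \<and> le A B} \<le>
        card ({B\<in>N. le A B} \<union> {B\<in>U. rk B = Suc i \<and> le A B})"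
      using fin by (intro card_mono) auto
    also have "\<dots> \<le> card {B\<in>N. le A B} + card {B\<in>U. rk B = Suc i \<and> le A B}"
      by (rule card_Un_le)
    finally show ?thesis
      using card_upper[of A] bspec[OF few that] that assms(1) bspec[OF rk_S that] \<open>i < m\<close> \<open>k \<le> q\<close>
      by auto
  qed
  have sub: "{A\<in>S. le A B} \<subseteq> {A\<in>X. Suc (rk A) = rk B \<and> le A B}" if "B \<in> N" for B
    using assms(1) rk_S N_rk[OF that] by auto
  have d: "card {A\<in>S. le A B} \<le> dn (Suc i)" if "B \<in> N" for B
    using card_mono[OF _ sub[OF that]] card_lower[of B] N_rk[OF that] \<open>i < m\<close> finite_X by simp
  have swap: "(\<Sum>A\<in>S. card {B\<in>N. le A B}) = (\<Sum>B\<in>N. card {A\<in>S. le A B})"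
    by (rule sum_multicount_gen) (use fin in auto)
  have low: "card S * (2 * dn (Suc i) + (q - k)) \<le> (\<Sum>A\<in>S. card {B\<in>N. le A B})"
    using sum_mono[of S "\<lambda>_. 2 * dn (Suc i) + (q - k)", OF c] by simp
  have high: "(\<Sum>B\<in>N. card {A\<in>S. le A B}) \<le> card N * dn (Suc i)"
    using sum_mono[of N _ "\<lambda>_. dn (Suc i)", OF d] by simp
  have key: "card S * (2 * dn (Suc i) + (q - k)) \<le> card N * dn (Suc i)"
    using low high swap by linarith
  then have "(2 * card S) * dn (Suc i) \<le> card N * dn (Suc i)"
    unfolding distrib_left by linarith
  then show "2 * card S \<le> card N" using dn_pos[of i] by (simp only: mult_le_cancel2)
  show "k = q" if "card N = 2 * card S" "S \<noteq> {}"
  proof -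
    have "card S * (q - k) = 0" using key that(1) by (simp add: algebra_simps)
    then show ?thesis using that(2) fin \<open>k \<le> q\<close> by simp
  qed
  show "A \<in> S" if *: "card N = 2 * card S" "B \<in> N" "A \<in> X" "rk A = i" "le A B"
  proof (rule ccontr)
    assume "A \<notin> S"
    \<comment> \<open>A lower cover of B missing from \<open>S\<close> makes one summand, hence the
      whole count, strictly smaller.\<close>
    then have "{A\<in>S. le A B} \<subset> {A\<in>X. Suc (rk A) = rk B \<and> le A B}"
      using sub[OF *(2)] * N_rk[OF *(2)] by auto
    then have "card {A\<in>S. le A B} < dn (Suc i)"
      using psubset_card_mono[of "{A\<in>X. Suc (rk A) = rk B \<and> le A B}"] card_lower[of B]
        N_rk[OF *(2)] \<open>i < m\<close> finite_X by simp
    then have "(\<Sum>B\<in>N. card {A\<in>S. le A B}) < (\<Sum>B\<in>N. dn (Suc i))"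
      using d fin(2) *(2) by (intro sum_strict_mono_ex1) auto
    then show False using low swap *(1) by (simp add: algebra_simps)
  qed
qed

text \<open>The lowest level of \<open>U\<close> is replaced by its whole upper shadow. This keeps the hypothesis on
  \<open>U\<close>, does not change the set of new elements of rank \<open>m\<close>, and at least doubles that level.\<close>

lemma shadow_doubling:
  assumes "U \<subseteq> X" and "\<And>A. A \<in> U \<Longrightarrow> i \<le> rk A \<and> rk A \<le> m" and "k \<le> q"
    and few: "\<And>A j. A \<in> U \<Longrightarrow> rk A < j \<Longrightarrow> card {B\<in>U. rk B = j \<and> le A B} < k"
  defines "W \<equiv> {A\<in>U. rk A < m}"
    and "G \<equiv> {B\<in>X. rk B = m \<and> B \<notin> U \<and> (\<exists>A\<in>U. rk A < m \<and> le A B)}"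
  shows "2 * card W \<le> card G \<and> (card G = 2 * card W \<longrightarrow>
    (W \<noteq> {} \<longrightarrow> k = q) \<and> (\<forall>B\<in>G. \<forall>A\<in>X. Suc (rk A) = m \<longrightarrow> le A B \<longrightarrow> A \<in> W))"
  using assms(1-4) unfolding W_def G_def
proof (induction "m - i" arbitrary: i U)
  case 0
  then have "{A\<in>U. rk A < m} = {}" by fastforce
  then show ?case by (auto simp: card_eq_0_iff)
next
  case (Suc r i U)
  note few = Suc.prems(4)
  let ?S = "{A\<in>U. rk A = i}"
  let ?N = "{B\<in>X. rk B = Suc i \<and> B \<notin> U \<and> (\<exists>A\<in>?S. le A B)}"
  have "i < m" using Suc.hyps(2) by simp
  have fin: "finite U" "finite ?N" "finite ?S"
    using Suc.prems(1) finite_X by (auto intro: finite_subset)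
  have sub: "?S \<subseteq> X" and rk_S: "\<forall>A\<in>?S. rk A = i"
    and few_S: "\<forall>A\<in>?S. card {B\<in>U. rk B = Suc i \<and> le A B} < k"
    using Suc.prems(1) few by auto
  note shadow = level_shadow[OF sub rk_S \<open>i < m\<close> Suc.prems(1,3) few_S]
  show ?case
  \<comment> \<open>Just below the middle, \<open>W\<close> and \<open>G\<close> are the
    \<open>S\<close> and \<open>N\<close> of \<open>level_shadow\<close>; from lower levels the
    induction moves up.\<close>
  proof (cases "Suc i = m")
    case True
    have W: "{A\<in>U. rk A < m} = ?S" using Suc.prems(2) True by force
    have G: "{B\<in>X. rk B = m \<and> B \<notin> U \<and> (\<exists>A\<in>U. rk A < m \<and> le A B)} = ?N"
      unfolding W[symmetric] True by auto
    show ?thesis unfolding W G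
    proof (intro conjI impI ballI)
      show "A \<in> ?S" if "card ?N = 2 * card ?S" "B \<in> ?N" "A \<in> X" "Suc (rk A) = m" "le A B" for A B
        using shadow(3)[OF that(1,2,3) _ that(5)] that(4) True by simp
    qed (use shadow in blast)+
  next
    case False
    define U' where "U' = (U - ?S) \<union> ?N"
    let ?W' = "{A\<in>U'. rk A < m}"
    have Sm: "Suc i < m" using False \<open>i < m\<close> by simp
    have G: "{B\<in>X. rk B = m \<and> B \<notin> U \<and> (\<exists>A\<in>U. rk A < m \<and> le A B)} =
      {B\<in>X. rk B = m \<and> B \<notin> U' \<and> (\<exists>A\<in>U'. rk A < m \<and> le A B)}" (is "?G = ?G'")
    proof (intro equalityI subsetI)
      fix B assume B: "B \<in> ?G"
      then obtain A where A: "A \<in> U" "rk A < m" "le A B" by auto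
      have "\<exists>A\<in>U'. rk A < m \<and> le A B"
      proof (cases "A \<in> ?S")
        case True
        \<comment> \<open>When A is removed, an upper cover C of A below B replaces it as a witness:
          C is either an old member or one of the new elements \<open>?N\<close>.\<close>
        then obtain C where C: "C \<in> X" "le A C" "le C B" "rk C = Suc i"
          using graded[of A B] A B Suc.prems(1) by auto
        then have "C \<in> U'" using True A(1) by (cases "C \<in> U") (simp_all add: U'_def, blast)
        then show ?thesis using C Sm by (intro bexI[of _ C]) simp_all
      qed (use A in \<open>auto simp: U'_def\<close>)
      with B Sm show "B \<in> ?G'" by (auto simp: U'_def)
    next
      fix B assume B: "B \<in> ?G'"
      then obtain A where A: "A \<in> U'" "rk A < m" "le A B" by auto
      have "\<exists>A\<in>U. rk A < m \<and> le A B"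
        using A \<open>i < m\<close> by (auto simp: U'_def intro: le_trans)
      with B \<open>i < m\<close> show "B \<in> ?G" by (auto simp: U'_def)
    qed
    have few': "card {B\<in>U'. rk B = j \<and> le A B} < k" if A: "A \<in> U'" and j: "rk A < j" for A j
    proof -
      have rkA: "Suc i \<le> rk A" using A Suc.prems(2) by (force simp: U'_def)
      \<comment> \<open>A new A lies above some removed A0. Members of \<open>U'\<close> above A of
        rank j are old members above A0, so the bound for A0 carries over.\<close>
      have "\<exists>A0\<in>U. rk A0 < j \<and> (A0 = A \<or> le A0 A)"
      proof (cases "A \<in> U")
        case False
        then obtain A0 where "A0 \<in> ?S" "le A0 A" using A unfolding U'_def by blast
        then show ?thesis using rkA j by (intro bexI[of _ A0]) auto
      qed (use j in blast)
      then obtain A0 where A0: "A0 \<in> U" "rk A0 < j" "A0 = A \<or> le A0 A" by blast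
      have "{B\<in>U'. rk B = j \<and> le A B} \<subseteq> {B\<in>U. rk B = j \<and> le A0 B}"
        using rkA j A0(3) le_trans by (auto simp: U'_def)
      then have "card {B\<in>U'. rk B = j \<and> le A B} \<le> card {B\<in>U. rk B = j \<and> le A0 B}"
        using fin(1) by (intro card_mono) auto
      also have "\<dots> < k" by (rule few[OF A0(1,2)])
      finally show ?thesis .
    qed
    have IH: "2 * card ?W' \<le> card ?G' \<and> (card ?G' = 2 * card ?W' \<longrightarrow>
      (?W' \<noteq> {} \<longrightarrow> k = q) \<and> (\<forall>B\<in>?G'. \<forall>A\<in>X. Suc (rk A) = m \<longrightarrow> le A B \<longrightarrow> A \<in> ?W'))"
    proof (rule Suc.hyps(1)[of "Suc i" U'])
      show "r = m - Suc i" using Suc.hyps(2) by simp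
      show "U' \<subseteq> X" using Suc.prems(1) by (auto simp: U'_def)
      show "Suc i \<le> rk A \<and> rk A \<le> m" if "A \<in> U'" for A
        using that Suc.prems(2) Sm by (force simp: U'_def)
      show "k \<le> q" by (rule Suc.prems(3))
    qed (rule few')
    show ?thesis
    proof (cases "?S = {}")
      case True
      then have "U' = U" by (auto simp: U'_def)
      show ?thesis using IH unfolding \<open>U' = U\<close> .
    next
      case False
      \<comment> \<open>A nonempty \<open>?S\<close> is replaced by at least twice as many elements.
        The bound then becomes strict and the equality clause is vacuous.\<close>
      have S_sub: "?S \<subseteq> {A\<in>U. rk A < m}" using \<open>i < m\<close> by blast
      have W': "?W' = ({A\<in>U. rk A < m} - ?S) \<union> ?N" using Sm by (auto simp: U'_def)
      have "card ?W' = card ({A\<in>U. rk A < m} - ?S) + card ?N"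
        unfolding W' by (rule card_Un_disjoint) (use fin(1,2) in auto)
      moreover have "card ({A\<in>U. rk A < m} - ?S) = card {A\<in>U. rk A < m} - card ?S"
        by (rule card_Diff_subset[OF fin(3) S_sub])
      moreover have "card ?S \<le> card {A\<in>U. rk A < m}"
        by (rule card_mono[OF _ S_sub]) (simp add: fin(1))
      moreover have "card ?S > 0" unfolding card_gt_0_iff using False fin(3) by blast
      ultimately have "2 * card {A\<in>U. rk A < m} < card ?G" unfolding G using IH shadow(1) by linarith
      then show ?thesis by simp
    qed
  qed
qed

end

section \<open>Forbidden configurations\<close>

lemma Field_V_poset: "Field (V_poset k) = {0..k}"
  by (auto simp: V_poset_def Field_def)

lemma Field_inclusion_order: "Field (inclusion_order F) = F"
  by (auto simp: inclusion_order_def Field_def)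

lemma induced_subposet_converse:
  "induced_subposet (P\<inverse>) (Q\<inverse>) \<longleftrightarrow> induced_subposet P Q"
  unfolding induced_subposet_def by auto

text \<open>Formulated for a general relation so that the converse of inclusion can be used for
  \<open>Lambda_poset\<close>.\<close>

lemma induced_V_posetI:
  assumes "A \<in> Field R" "S \<subseteq> Field R" "finite S" "card S = k"
    and refl: "\<And>x. x \<in> Field R \<Longrightarrow> (x, x) \<in> R"
    and above: "\<And>B. B \<in> S \<Longrightarrow> (A, B) \<in> R \<and> (B, A) \<notin> R"
    and antichain: "\<And>B C. B \<in> S \<Longrightarrow> C \<in> S \<Longrightarrow> (B, C) \<in> R \<Longrightarrow> B = C"
  shows "induced_subposet (V_poset k) R"
proof -
  obtain f where f: "bij_betw f {1..k} S"
    using ex_bij_betw_nat_finite_1[OF \<open>finite S\<close>] assms(4) by auto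
  define \<phi> where "\<phi> i = (if i = 0 then A else f i)" for i
  have fS: "f i \<in> S" if "0 < i" "i \<le> k" for i
    using that f by (auto simp: bij_betw_def)
  have finj: "i = j" if "f i = f j" "0 < i" "i \<le> k" "0 < j" "j \<le> k" for i j
    using that f by (auto simp: bij_betw_def dest: inj_onD)
  have AS: "A \<notin> S" using above by blast
  have "inj_on \<phi> {0..k}"
    by (rule inj_onI) (use AS fS finj in \<open>force simp: \<phi>_def split: if_splits\<close>)
  moreover have "\<phi> ` {0..k} \<subseteq> Field R"
    using fS assms(1,2) by (auto simp: \<phi>_def)
  moreover have "(i, j) \<in> V_poset k \<longleftrightarrow> (\<phi> i, \<phi> j) \<in> R" if ij: "i \<le> k" "j \<le> k" for i j
  proof (cases "i = 0 \<or> j = 0")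
    case True
    then show ?thesis
      using ij above fS refl[OF assms(1)] by (auto simp: \<phi>_def V_poset_def)
  next
    case False
    then have "(\<phi> i, \<phi> j) \<in> R \<longleftrightarrow> i = j"
      using ij antichain[of "f i" "f j"] fS finj refl subsetD[OF assms(2)] by (auto simp: \<phi>_def)
    then show ?thesis using False ij by (auto simp: V_poset_def)
  qed
  ultimately show ?thesis
    unfolding induced_subposet_def Field_V_poset by (intro exI[of _ \<phi>]) auto
qed

section \<open>Counting subspaces over a finite field\<close>

text \<open>This counts the one-dimensional subspaces of a d-dimensional space and, dually, its
  hyperplanes. The sum stays in the natural numbers, where the quotient form would need
  division.\<close>

definition q_bracket :: "nat \<Rightarrow> nat \<Rightarrow> nat" where
  "q_bracket q d = (\<Sum>j<d. q ^ j)"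

lemma q_bracket_0 [simp]: "q_bracket q 0 = 0"
  by (simp add: q_bracket_def)

lemma q_bracket_Suc: "q_bracket q (Suc d) = 1 + q * q_bracket q d"
  unfolding q_bracket_def by (simp add: sum.lessThan_Suc_shift sum_distrib_left del: sum.lessThan_Suc)

lemma q_bracket_mono: "a \<le> b \<Longrightarrow> q_bracket q a \<le> q_bracket q b"
  unfolding q_bracket_def by (rule sum_mono2) auto

lemma q_bracket_power: "1 \<le> q \<Longrightarrow> (q - 1) * q_bracket q d + 1 = q ^ d"
proof (induction d)
  case (Suc d)
  obtain p where q: "q = Suc p" using Suc.prems by (cases q) auto
  have "q ^ Suc d = q * ((q - 1) * q_bracket q d + 1)" using Suc by simp
  also have "\<dots> = (q - 1) * q_bracket q (Suc d) + 1"
    unfolding q_bracket_Suc q by (simp add: algebra_simps)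
  finally show ?case by simp
qed simp

lemma q_bracket_eq: "2 \<le> q \<Longrightarrow> real (q_bracket q d) = (real q ^ d - 1) / (real q - 1)"
  using arg_cong[OF q_bracket_power[of q d], of real] by (simp add: of_nat_diff field_simps)

text \<open>By monotonicity d = i + 2 is the worst case. There the recursion [i+2] = 1 + q[i+1]
  turns the claim into (q - 2)([i+1] - 1) \<ge> 0.\<close>

lemma q_bracket_doubling:
  assumes "2 \<le> q" "Suc (Suc i) \<le> d"
  shows "2 * q_bracket q (Suc i) + q \<le> q_bracket q d + 1"
proof -
  obtain p where q: "q = p + 2" using assms(1) by (metis le_add_diff_inverse2)
  obtain x where x: "q_bracket q (Suc i) = Suc x" by (simp add: q_bracket_Suc)
  have "2 * q_bracket q (Suc i) + q \<le> q_bracket q (Suc (Suc i)) + 1"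
    unfolding q_bracket_Suc[of q "Suc i"] x unfolding q by (simp add: algebra_simps)
  then show ?thesis using q_bracket_mono[OF assms(2), of q] by linarith
qed

lemma gauss_binomial_Suc:
  "gauss_binomial q n (Suc k) =
     gauss_binomial q n k * ((real q ^ (n - k) - 1) / (real q ^ Suc k - 1))"
proof -
  \<comment> \<open>The denominators \<open>k - i\<close> shift with k, so their first factor is
    split off, whereas the numerators gain a last one.\<close>
  have "(\<Prod>i<Suc k. real q ^ (Suc k - i) - 1) =
      (real q ^ Suc k - 1) * (\<Prod>i<k. real q ^ (k - i) - 1)"
    by (subst prod.lessThan_Suc_shift) simp
  then show ?thesis
    unfolding gauss_binomial_def prod_dividef by (simp add: mult_ac)
qed

section \<open>Cardinalities of subspaces and of their covers\<close>

locale finite_vector_space = finite_dimensional_vector_space scale Basis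
  for scale :: "'a::{field,finite} \<Rightarrow> 'b::ab_group_add \<Rightarrow> 'b" (infixr \<open>*s\<close> 75)
    and Basis :: "'b set" +
  fixes q :: nat
  assumes card_scalars: "card (UNIV :: 'a set) = q"
begin

lemma two_le_q: "2 \<le> q"
proof -
  have "card {0, 1 :: 'a} \<le> q" unfolding card_scalars[symmetric] by (rule card_mono) auto
  then show ?thesis by simp
qed

text \<open>Adding b to the basis multiplies the size by q, since (c, x) \<mapsto> cb + x is a
  bijection onto the larger span.\<close>

lemma card_span_independent:
  assumes "finite B" "independent B"
  shows "finite (span B) \<and> card (span B) = q ^ card B"
  using assms
proof (induction B)
  case (insert b B)
  have b: "b \<notin> span B" and ind: "independent B"
    using insert.prems insert.hyps(2) by (auto simp: independent_insert)
  let ?f = "\<lambda>(c, x). c *s b + x"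
  have "span (insert b B) = ?f ` (UNIV \<times> span B)"
  proof (intro equalityI subsetI)
    fix x assume "x \<in> span (insert b B)"
    then obtain c where "x - c *s b \<in> span B" by (auto simp: span_insert)
    then show "x \<in> ?f ` (UNIV \<times> span B)"
      by (intro image_eqI[of _ _ "(c, x - c *s b)"]) auto
  next
    fix x assume "x \<in> ?f ` (UNIV \<times> span B)"
    then obtain c y where "x = c *s b + y" "y \<in> span B" by auto
    then show "x \<in> span (insert b B)"
      unfolding span_insert by (auto intro!: exI[of _ c])
  qed
  moreover have "inj_on ?f (UNIV \<times> span B)"
  proof (rule inj_onI, clarify)
    fix c x d y assume xy: "x \<in> span B" "y \<in> span B" "c *s b + x = d *s b + y"
    then have "(c - d) *s b = y - x" by (simp add: scale_left_diff_distrib algebra_simps)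
    then have "(c - d) *s b \<in> span B" using xy by (simp add: span_diff)
    \<comment> \<open>If c and d differ, dividing by c - d puts b into \<open>span B\<close>, a
      contradiction.\<close>
    then have "inverse (c - d) *s (c - d) *s b \<in> span B" by (rule span_scale)
    then have "c = d" using b by (cases "c = d") auto
    then show "c = d \<and> x = y" using xy by simp
  qed
  ultimately show ?case
    using insert.IH[OF ind] insert.hyps
    by (simp add: card_image card_cartesian_product card_scalars)
qed simp

lemma card_subspace:
  assumes "subspace S"
  shows "card S = q ^ dim S"
proof -
  obtain B where "B \<subseteq> S" "independent B" "S \<subseteq> span B" "card B = dim S"
    using basis_exists by blast
  then show ?thesis
    using card_span_independent[of B] finiteI_independent span_subspace assms by metis
qed

lemma finite_space: "finite (UNIV :: 'b set)"
  using card_span_independent[OF finite_Basis independent_Basis] by (simp add: span_Basis)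

lemma finite_subset_space [simp]: "finite (S :: 'b set)"
  using finite_space by (rule rev_finite_subset) simp

lemma finite_set_of_subsets [simp]: "finite (F :: 'b set set)"
  by (rule rev_finite_subset[of "Pow UNIV"]) (simp_all only: finite_Pow_iff finite_space, simp)

text \<open>Count pairs of a vector v in \<open>B - A\<close> and a cover C containing it. Each v
  lies in exactly one cover, the span of A and v, and each C contains
  \<open>q ^ Suc (dim A) - q ^ dim A\<close> of these vectors.\<close>

lemma card_covers_between:
  assumes A: "subspace A" and B: "subspace B" and "A \<subseteq> B"
  shows "card {C. subspace C \<and> A \<subseteq> C \<and> C \<subseteq> B \<and> dim C = Suc (dim A)} = q_bracket q (dim B - dim A)"
proof -
  let ?S = "{C. subspace C \<and> A \<subseteq> C \<and> C \<subseteq> B \<and> dim C = Suc (dim A)}"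
  have one: "{C\<in>?S. v \<in> C} = {span (insert v A)}" if v: "v \<in> B - A" for v
  proof -
    have sp: "span A = A" using A by (simp only: span_eq_iff)
    have dim: "dim (insert v A) = Suc (dim A)" using v unfolding dim_insert sp by simp
    have "span (insert v A) \<subseteq> B" using v B \<open>A \<subseteq> B\<close> by (intro span_minimal) auto
    moreover have "A \<subseteq> span (insert v A)" "v \<in> span (insert v A)"
      by (auto intro: span_base)
    moreover have "span (insert v A) = C" if "C \<in> ?S" "v \<in> C" for C
    proof (rule subspace_dim_equal)
      show "span (insert v A) \<subseteq> C" using that by (intro span_minimal) auto
    qed (use that dim in auto)
    ultimately show ?thesis using dim by auto
  qed
  have "(\<Sum>v\<in>B - A. card {C\<in>?S. v \<in> C}) = (q ^ Suc (dim A) - q ^ dim A) * card ?S"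
  proof (rule sum_multicount)
    show "\<forall>C\<in>?S. card {v\<in>B - A. v \<in> C} = q ^ Suc (dim A) - q ^ dim A"
    proof
      fix C assume C: "C \<in> ?S"
      then have "{v\<in>B - A. v \<in> C} = C - A" by auto
      then show "card {v\<in>B - A. v \<in> C} = q ^ Suc (dim A) - q ^ dim A"
        using C A by (simp add: card_Diff_subset card_subspace del: power_Suc)
    qed
  qed auto
  moreover have "(\<Sum>v\<in>B - A. card {C\<in>?S. v \<in> C}) = (\<Sum>v\<in>B - A. 1)"
    by (rule sum.cong[OF refl]) (simp only: one, simp)
  ultimately have "q ^ dim B - q ^ dim A = (q ^ Suc (dim A) - q ^ dim A) * card ?S"
    using A B \<open>A \<subseteq> B\<close> by (simp add: card_Diff_subset card_subspace)
  moreover have "q ^ dim B - q ^ dim A = q ^ dim A * ((q - 1) * q_bracket q (dim B - dim A))"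
  proof -
    have "q ^ dim B = q ^ dim A * q ^ (dim B - dim A)"
      using dim_subset[OF \<open>A \<subseteq> B\<close>] by (simp flip: power_add)
    also have "q ^ (dim B - dim A) = (q - 1) * q_bracket q (dim B - dim A) + 1"
      using q_bracket_power[of q] two_le_q by simp
    finally show ?thesis by (simp add: algebra_simps)
  qed
  moreover have "q ^ Suc (dim A) - q ^ dim A = q ^ dim A * (q - 1)"
    by (simp add: algebra_simps)
  ultimately have "(q ^ dim A * (q - 1)) * card ?S =
      (q ^ dim A * (q - 1)) * q_bracket q (dim B - dim A)"
    by (simp only: mult.assoc)
  moreover have "q ^ dim A * (q - 1) \<noteq> 0" using two_le_q by simp
  ultimately show ?thesis by (simp only: mult_cancel1) blast
qed

text \<open>The sum of two distinct hyperplanes is all of B, so the dimension formula for sums and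
  intersections applies.\<close>

lemma dim_Int_hyperplanes:
  assumes H: "subspace H" "H \<subseteq> B" "Suc (dim H) = dim B"
    and C: "subspace C" "C \<subseteq> B" "Suc (dim C) = dim B" and "subspace B" "C \<noteq> H"
  shows "Suc (dim (C \<inter> H)) = dim H"
proof -
  let ?S = "{x + y |x y. x \<in> C \<and> y \<in> H}"
  have sub: "subspace ?S" using H C by (intro subspace_sums)
  have "?S \<subseteq> B" using H C \<open>subspace B\<close> subspace_add by blast
  then have le: "dim ?S \<le> dim B" by (rule dim_subset)
  have CS: "C \<subseteq> ?S" using H(1) subspace_0 by force
  have HS: "H \<subseteq> ?S" using C(1) subspace_0 by force
  have "dim ?S = dim B"
  proof (rule ccontr)
    assume "dim ?S \<noteq> dim B"
    then have "dim ?S \<le> dim C" "dim ?S \<le> dim H" using le H(3) C(3) by auto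
    then have "C = ?S" "H = ?S"
      using subspace_dim_equal[OF C(1) sub CS] subspace_dim_equal[OF H(1) sub HS] by blast+
    then show False using \<open>C \<noteq> H\<close> by simp
  qed
  then show ?thesis using dim_sums_Int[OF C(1) H(1)] H(3) C(3) by simp
qed

text \<open>Fix a hyperplane \<open>H\<close>. Each hyperplane \<open>K\<close> of \<open>H\<close> lies in \<open>q + 1\<close> hyperplanes of \<open>B\<close>, so \<open>K = C \<inter> H\<close>
  for exactly \<open>q\<close> hyperplanes \<open>C \<noteq> H\<close>, which gives the recursion of \<open>q_bracket\<close>.\<close>

lemma card_hyperplanes:
  assumes "subspace B"
  shows "card {C. subspace C \<and> C \<subseteq> B \<and> Suc (dim C) = dim B} = q_bracket q (dim B)"
  using assms
proof (induction "dim B" arbitrary: B)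
  case 0
  show ?case unfolding 0(1)[symmetric] by simp
next
  case (Suc d B)
  obtain H where H: "subspace H" "H \<subseteq> B" "dim H = d"
    using choose_subspace_of_subspace[of d B] Suc by (metis Suc_n_not_le_n nat_le_linear span_eq_iff)
  let ?H = "{C. subspace C \<and> C \<subseteq> B \<and> Suc (dim C) = dim B}"
  let ?K = "{K. subspace K \<and> K \<subseteq> H \<and> Suc (dim K) = dim H}"
  have dimB: "dim B = Suc d" using Suc.hyps(2) by simp
  have int: "Suc (dim (C \<inter> H)) = d" if "C \<in> ?H - {H}" for C
    using dim_Int_hyperplanes[of H B C] that H dimB Suc.prems by auto
  have "(\<Sum>C\<in>?H - {H}. card {K\<in>?K. K \<subseteq> C}) = q * card ?K"
  proof (rule sum_multicount)
    show "\<forall>K\<in>?K. card {C\<in>?H - {H}. K \<subseteq> C} = q"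
    proof
      fix K assume K: "K \<in> ?K"
      let ?T = "{C. subspace C \<and> K \<subseteq> C \<and> C \<subseteq> B \<and> dim C = Suc (dim K)}"
      have "{C\<in>?H - {H}. K \<subseteq> C} = ?T - {H}" using K H dimB by auto
      moreover have "H \<in> ?T" using K H by auto
      moreover have "card ?T = q_bracket q (Suc (Suc 0))"
      proof -
        have "dim B - dim K = Suc (Suc 0)" "K \<subseteq> B" using K H dimB by auto
        then show ?thesis using card_covers_between[of K B] K Suc.prems by simp
      qed
      ultimately show "card {C\<in>?H - {H}. K \<subseteq> C} = q"
        by (simp add: q_bracket_Suc)
    qed
  qed auto
  moreover have "card {K\<in>?K. K \<subseteq> C} = 1" if C: "C \<in> ?H - {H}" for C
  proof -
    have "K = C \<inter> H" if "K \<in> ?K" "K \<subseteq> C" for K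
      using that C int[OF C] H by (intro subspace_dim_equal) (auto intro: subspace_inter)
    then have "{K\<in>?K. K \<subseteq> C} = {C \<inter> H}"
      using C int[OF C] H by (auto intro: subspace_inter)
    then show ?thesis by simp
  qed
  ultimately have "card (?H - {H}) = q * card ?K" by simp
  moreover have "card ?K = q_bracket q d" using Suc.hyps(1)[of H] H by simp
  moreover have "card ?H = Suc (card (?H - {H}))"
    by (rule card.remove) (use H dimB in auto)
  ultimately show ?case by (simp add: dimB q_bracket_Suc)
qed

text \<open>Double counting of incident pairs of subspaces of dimensions k and k + 1.\<close>

lemma card_subspaces_of_dim_Suc:
  "card (subspaces_of_dim scale (Suc k)) * q_bracket q (Suc k) =
   card (subspaces_of_dim scale k) * q_bracket q (dim UNIV - k)"
proof -
  let ?A = "subspaces_of_dim scale k" and ?B = "subspaces_of_dim scale (Suc k)"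
  have "(\<Sum>A\<in>?A. card {B\<in>?B. A \<subseteq> B}) = q_bracket q (Suc k) * card ?B"
  proof (rule sum_multicount)
    show "\<forall>B\<in>?B. card {A\<in>?A. A \<subseteq> B} = q_bracket q (Suc k)"
    proof
      fix B assume B: "B \<in> ?B"
      then have "{A\<in>?A. A \<subseteq> B} = {C. subspace C \<and> C \<subseteq> B \<and> Suc (dim C) = dim B}"
        by (auto simp: subspaces_of_dim_def subspaces_def)
      then show "card {A\<in>?A. A \<subseteq> B} = q_bracket q (Suc k)"
        using card_hyperplanes[of B] B by (simp add: subspaces_of_dim_def subspaces_def)
    qed
  qed auto
  moreover have "card {B\<in>?B. A \<subseteq> B} = q_bracket q (dim UNIV - k)" if "A \<in> ?A" for A
  proof -
    have "{B\<in>?B. A \<subseteq> B} = {C. subspace C \<and> A \<subseteq> C \<and> C \<subseteq> UNIV \<and> dim C = Suc (dim A)}"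
      using that by (auto simp: subspaces_of_dim_def subspaces_def)
    then show ?thesis
      using card_covers_between[of A UNIV] that by (simp add: subspaces_of_dim_def subspaces_def)
  qed
  ultimately show ?thesis by (simp add: mult.commute)
qed

lemma card_subspaces_of_dim:
  "real (card (subspaces_of_dim scale k)) = gauss_binomial q (dim UNIV) k"
proof (induction k)
  case 0
  have "subspaces_of_dim scale 0 = {{0}}"
    by (auto simp: subspaces_of_dim_def subspaces_def dest: subspace_0)
  then show ?case by (simp add: gauss_binomial_def)
next
  case (Suc k)
  let ?N = "card (subspaces_of_dim scale (Suc k))"
  have q: "real q - 1 \<noteq> 0" "real q ^ Suc k - 1 \<noteq> 0"
    using two_le_q one_less_power[of "real q" "Suc k"] by auto
  have "real ?N * real (q_bracket q (Suc k)) =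
      gauss_binomial q (dim UNIV) k * real (q_bracket q (dim UNIV - k))"
    using arg_cong[OF card_subspaces_of_dim_Suc[of k], of real] Suc by simp
  then have "real ?N * (real q ^ Suc k - 1) =
      gauss_binomial q (dim UNIV) k * (real q ^ (dim UNIV - k) - 1)"
    unfolding q_bracket_eq[OF two_le_q] using q(1) by (simp add: divide_simps del: power_Suc dim_UNIV)
  then show ?case
    unfolding gauss_binomial_Suc using q(2) by (simp add: divide_simps del: power_Suc dim_UNIV)
qed

section \<open>The subspace lattice and its dual as doubling posets\<close>

lemma subspace_between:
  assumes "subspace A" "subspace B" "A \<subseteq> B" "dim A < dim B"
  shows "\<exists>C. subspace C \<and> A \<subseteq> C \<and> C \<subseteq> B \<and> dim C = Suc (dim A)"
proof -
  have "0 < q_bracket q (dim B - dim A)"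
    using assms(4) q_bracket_Suc[of q "dim B - Suc (dim A)"] by (simp add: Suc_diff_Suc)
  then have "{C. subspace C \<and> A \<subseteq> C \<and> C \<subseteq> B \<and> dim C = Suc (dim A)} \<noteq> {}"
    using card_covers_between[OF assms(1-3)] by fastforce
  then show ?thesis by blast
qed

text \<open>Climb from A one dimension at a time inside B. This gives gradedness for the reversed
  order.\<close>

lemma hyperplane_between:
  assumes "subspace A" "subspace B" "A \<subseteq> B" "dim A < dim B"
  shows "\<exists>C. subspace C \<and> A \<subseteq> C \<and> C \<subseteq> B \<and> Suc (dim C) = dim B"
  using assms
proof (induction "dim B - dim A" arbitrary: A)
  case (Suc d A)
  obtain C where C: "subspace C" "A \<subseteq> C" "C \<subseteq> B" "dim C = Suc (dim A)"
    using subspace_between[of A B] Suc.prems by auto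
  show ?case
  proof (cases "dim C = dim B")
    case True
    then show ?thesis using C Suc.prems by auto
  next
    case False
    then have "dim C < dim B" using dim_subset[OF C(3)] by simp
    moreover have "d = dim B - dim C" using Suc.hyps(2) C(4) by simp
    ultimately obtain D where "subspace D" "C \<subseteq> D" "D \<subseteq> B" "Suc (dim D) = dim B"
      using Suc.hyps(1)[of C] C Suc.prems by blast
    then show ?thesis using C(2) by blast
  qed
qed simp

lemma dim_le_UNIV: "dim A \<le> dim UNIV"
  by (rule dim_subset) simp

text \<open>The even dimension enters here: i < m gives 2m - i \<ge> i + 2, as
  \<open>q_bracket_doubling\<close> demands.\<close>

lemma doubling_subset:
  assumes "dim UNIV = 2 * m"
  shows "doubling_poset (subspaces scale) (\<subseteq>) dim (q_bracket q) m q"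
proof
  fix A assume A: "A \<in> subspaces scale" "dim A < m"
  have "{B \<in> subspaces scale. dim B = Suc (dim A) \<and> A \<subseteq> B} =
      {C. subspace C \<and> A \<subseteq> C \<and> C \<subseteq> UNIV \<and> dim C = Suc (dim A)}"
    by (auto simp: subspaces_def)
  then have "card {B \<in> subspaces scale. dim B = Suc (dim A) \<and> A \<subseteq> B} = q_bracket q (2 * m - dim A)"
    using card_covers_between[of A UNIV] A assms by (simp add: subspaces_def)
  then show "2 * q_bracket q (Suc (dim A)) + q
      \<le> card {B \<in> subspaces scale. dim B = Suc (dim A) \<and> A \<subseteq> B} + 1"
    using q_bracket_doubling[OF two_le_q, of "dim A" "2 * m - dim A"] A(2) by simp
next
  fix B assume B: "B \<in> subspaces scale" "dim B \<le> m"
  have "{A \<in> subspaces scale. Suc (dim A) = dim B \<and> A \<subseteq> B} =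
      {C. subspace C \<and> C \<subseteq> B \<and> Suc (dim C) = dim B}"
    by (auto simp: subspaces_def)
  then show "card {A \<in> subspaces scale. Suc (dim A) = dim B \<and> A \<subseteq> B} = q_bracket q (dim B)"
    using card_hyperplanes[of B] B by (simp add: subspaces_def)
next
  fix A B assume "A \<in> subspaces scale" "B \<in> subspaces scale" "A \<subseteq> B" "dim A < dim B"
  then show "\<exists>C\<in>subspaces scale. A \<subseteq> C \<and> C \<subseteq> B \<and> dim C = Suc (dim A)"
    using subspace_between[of A B] by (auto simp: subspaces_def)
qed (auto simp: q_bracket_Suc)

text \<open>No dual space is formed. Under reversal the two counts trade places: upper covers are
  hyperplanes, and lower covers are subspaces one dimension larger.\<close>

lemma doubling_supset:
  assumes "dim UNIV = 2 * m"
  shows "doubling_poset (subspaces scale) (\<supseteq>) (\<lambda>A. dim UNIV - dim A) (q_bracket q) m q"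
proof
  fix A assume A: "A \<in> subspaces scale" "dim UNIV - dim A < m"
  have "{B \<in> subspaces scale. dim UNIV - dim B = Suc (dim UNIV - dim A) \<and> B \<subseteq> A} =
      {C. subspace C \<and> C \<subseteq> A \<and> Suc (dim C) = dim A}"
    using dim_le_UNIV[of A] A(2) assms by (auto simp: subspaces_def)
  then have "card {B \<in> subspaces scale. dim UNIV - dim B = Suc (dim UNIV - dim A) \<and> B \<subseteq> A}
      = q_bracket q (dim A)"
    using card_hyperplanes[of A] A by (simp add: subspaces_def)
  then show "2 * q_bracket q (Suc (dim UNIV - dim A)) + q
      \<le> card {B \<in> subspaces scale. dim UNIV - dim B = Suc (dim UNIV - dim A) \<and> B \<subseteq> A} + 1"
    using q_bracket_doubling[OF two_le_q, of "dim UNIV - dim A" "dim A"] A(2) assms by simp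
next
  fix B assume B: "B \<in> subspaces scale" "dim UNIV - dim B \<le> m"
  have "Suc (dim UNIV - dim A) = dim UNIV - dim B \<longleftrightarrow> dim A = Suc (dim B)" for A
    using dim_le_UNIV[of A] dim_le_UNIV[of B] by linarith
  then have "{A \<in> subspaces scale. Suc (dim UNIV - dim A) = dim UNIV - dim B \<and> B \<subseteq> A} =
      {C. subspace C \<and> B \<subseteq> C \<and> C \<subseteq> UNIV \<and> dim C = Suc (dim B)}"
    by (auto simp: subspaces_def)
  then show "card {A \<in> subspaces scale. Suc (dim UNIV - dim A) = dim UNIV - dim B \<and> B \<subseteq> A}
      = q_bracket q (dim UNIV - dim B)"
    using card_covers_between[of B UNIV] B by (simp add: subspaces_def)
next
  fix A B assume AB: "A \<in> subspaces scale" "B \<in> subspaces scale" "B \<subseteq> A"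
    "dim UNIV - dim A < dim UNIV - dim B"
  then have "dim B < dim A" using dim_le_UNIV[of A] by linarith
  then obtain C where "subspace C" "B \<subseteq> C" "C \<subseteq> A" "Suc (dim C) = dim A"
    using hyperplane_between[of B A] AB by (auto simp: subspaces_def)
  then show "\<exists>C\<in>subspaces scale. C \<subseteq> A \<and> B \<subseteq> C \<and> dim UNIV - dim C = Suc (dim UNIV - dim A)"
    using dim_le_UNIV[of A] by (intro bexI[of _ C]) (auto simp: subspaces_def)
qed (auto simp: q_bracket_Suc)

section \<open>Families avoiding both configurations\<close>

lemma free_family_few_above:
  assumes free: "\<not> induced_subposet (V_poset k) (inclusion_order F)"
    and "F \<subseteq> subspaces scale" "A \<in> F" "dim A \<noteq> j"
  shows "card {B\<in>F. dim B = j \<and> A \<subseteq> B} < k"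
proof (rule ccontr)
  assume "\<not> card {B\<in>F. dim B = j \<and> A \<subseteq> B} < k"
  then have "k \<le> card {B\<in>F. dim B = j \<and> A \<subseteq> B}" by simp
  then obtain S where S: "S \<subseteq> {B\<in>F. dim B = j \<and> A \<subseteq> B}" "card S = k"
    by (rule obtain_subset_with_card_n)
  have SD: "B \<in> F \<and> subspace B \<and> dim B = j \<and> A \<subseteq> B" if "B \<in> S" for B
    using that S(1) assms(2) by (auto simp: subspaces_def)
  \<comment> \<open>Distinct subspaces of equal dimension are incomparable, so k of them above A
    form an induced copy.\<close>
  have "induced_subposet (V_poset k) (inclusion_order F)"
  proof (rule induced_V_posetI[where A = A and S = S])
    show "(A, B) \<in> inclusion_order F \<and> (B, A) \<notin> inclusion_order F" if "B \<in> S" for B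
      using SD[OF that] assms(3,4) by (auto simp: inclusion_order_def)
    show "B = C" if "B \<in> S" "C \<in> S" "(B, C) \<in> inclusion_order F" for B C
      using SD[OF that(1)] SD[OF that(2)] that(3)
      by (intro subspace_dim_equal) (auto simp: inclusion_order_def)
    show "S \<subseteq> Field (inclusion_order F)" using SD unfolding Field_inclusion_order by blast
    show "A \<in> Field (inclusion_order F)" using assms(3) by (simp add: Field_inclusion_order)
    show "(B, B) \<in> inclusion_order F" if "B \<in> Field (inclusion_order F)" for B
      using that unfolding Field_inclusion_order by (simp add: inclusion_order_def)
  qed (use S(2) in simp_all)
  with free show False ..
qed

lemma free_family_few_below:
  assumes free: "\<not> induced_subposet (Lambda_poset l) (inclusion_order F)"
    and "F \<subseteq> subspaces scale" "A \<in> F" "dim A \<noteq> j"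
  shows "card {B\<in>F. dim B = j \<and> B \<subseteq> A} < l"
proof (rule ccontr)
  assume "\<not> card {B\<in>F. dim B = j \<and> B \<subseteq> A} < l"
  then have "l \<le> card {B\<in>F. dim B = j \<and> B \<subseteq> A}" by simp
  then obtain S where S: "S \<subseteq> {B\<in>F. dim B = j \<and> B \<subseteq> A}" "card S = l"
    by (rule obtain_subset_with_card_n)
  have SD: "B \<in> F \<and> subspace B \<and> dim B = j \<and> B \<subseteq> A" if "B \<in> S" for B
    using that S(1) assms(2) by (auto simp: subspaces_def)
  have "induced_subposet (V_poset l) ((inclusion_order F)\<inverse>)"
  proof (rule induced_V_posetI[where A = A and S = S])
    show "(A, B) \<in> (inclusion_order F)\<inverse> \<and> (B, A) \<notin> (inclusion_order F)\<inverse>" if "B \<in> S" for B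
      using SD[OF that] assms(3,4) by (auto simp: inclusion_order_def)
    show "B = C" if "B \<in> S" "C \<in> S" "(B, C) \<in> (inclusion_order F)\<inverse>" for B C
      using SD[OF that(1)] SD[OF that(2)] that(3)
      by (intro subspace_dim_equal[symmetric]) (auto simp: inclusion_order_def)
    show "S \<subseteq> Field ((inclusion_order F)\<inverse>)"
      using SD unfolding Field_converse Field_inclusion_order by blast
    show "A \<in> Field ((inclusion_order F)\<inverse>)"
      using assms(3) by (simp add: Field_inclusion_order)
    show "(B, B) \<in> (inclusion_order F)\<inverse>" if "B \<in> Field ((inclusion_order F)\<inverse>)" for B
      using that unfolding Field_converse Field_inclusion_order by (simp add: inclusion_order_def)
  qed (use S(2) in simp_all)
  then show False
    using free induced_subposet_converse[of "V_poset l" "(inclusion_order F)\<inverse>"]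
    by (simp add: Lambda_poset_def)
qed

text \<open>\<open>Wlo\<close> and \<open>Whi\<close> each have at most half the size of
  \<open>M - F\<close>, so swapping both for \<open>M - F\<close> loses nothing. The exception is
  genuine: for m = 1 and k = l = q, the zero space, the whole space and q - 1 lines also make q + 1
  members.\<close>

lemma induced_free_family_le_middle:
  assumes dim: "dim UNIV = 2 * m" and "k \<le> q" "l \<le> q"
    and free: "induced_free_family scale {V_poset k, Lambda_poset l} F"
  defines "M \<equiv> subspaces_of_dim scale m"
  shows "card F \<le> card M"
    and "card F = card M \<Longrightarrow> F = M \<or> m = 1 \<and> k = q \<and> l = q"
proof -
  let ?X = "subspaces scale"
  define Wlo Whi where "Wlo = {A\<in>F. dim A < m}" and "Whi = {A\<in>F. m < dim A}"
  define Glo Ghi where "Glo = {B\<in>M - F. \<exists>A\<in>Wlo. A \<subseteq> B}" and "Ghi = {B\<in>M - F. \<exists>A\<in>Whi. B \<subseteq> A}"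
  have F: "F \<subseteq> ?X" using free by (simp add: induced_free_family_def)
  have M: "B \<in> M \<longleftrightarrow> B \<in> ?X \<and> dim B = m" for B by (simp add: M_def subspaces_of_dim_def)
  have above: "card {B\<in>F. dim B = j \<and> A \<subseteq> B} < k" if "A \<in> F" "dim A \<noteq> j" for A j
    using free_family_few_above[OF _ F that] free by (auto simp: induced_free_family_def)
  have below: "card {B\<in>F. dim B = j \<and> B \<subseteq> A} < l" if "A \<in> F" "dim A \<noteq> j" for A j
    using free_family_few_below[OF _ F that] free by (auto simp: induced_free_family_def)
  have lo: "2 * card Wlo \<le> card Glo \<and> (card Glo = 2 * card Wlo \<longrightarrow>
    (Wlo \<noteq> {} \<longrightarrow> k = q) \<and> (\<forall>B\<in>Glo. \<forall>A\<in>?X. Suc (dim A) = m \<longrightarrow> A \<subseteq> B \<longrightarrow> A \<in> Wlo))"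
  proof -
    interpret doubling_poset ?X "(\<subseteq>)" dim "q_bracket q" m q by (rule doubling_subset[OF dim])
    \<comment> \<open>The middle level stays in \<open>?U\<close>, so that \<open>Glo\<close> counts
      only middle subspaces outside F.\<close>
    let ?U = "{A\<in>F. dim A \<le> m}"
    have few: "card {B\<in>?U. dim B = j \<and> A \<subseteq> B} < k" if "A \<in> ?U" "dim A < j" for A j
    proof -
      have "card {B\<in>?U. dim B = j \<and> A \<subseteq> B} \<le> card {B\<in>F. dim B = j \<and> A \<subseteq> B}"
        by (rule card_mono) auto
      also have "\<dots> < k" using above[of A j] that by simp
      finally show ?thesis .
    qed
    have W: "{A\<in>?U. dim A < m} = Wlo" by (auto simp: Wlo_def)
    have G: "{B\<in>?X. dim B = m \<and> B \<notin> ?U \<and> (\<exists>A\<in>?U. dim A < m \<and> A \<subseteq> B)} = Glo"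
      unfolding Glo_def W[symmetric] by (auto simp: M)
    show ?thesis
      using shadow_doubling[of ?U 0 k] few F \<open>k \<le> q\<close> unfolding W G by blast
  qed
  have hi: "2 * card Whi \<le> card Ghi \<and> (card Ghi = 2 * card Whi \<longrightarrow> (Whi \<noteq> {} \<longrightarrow> l = q))"
  proof -
    let ?rk = "\<lambda>A. dim UNIV - dim A"
    interpret doubling_poset ?X "(\<supseteq>)" ?rk "q_bracket q" m q by (rule doubling_supset[OF dim])
    let ?U = "{A\<in>F. ?rk A \<le> m}"
    have few: "card {B\<in>?U. ?rk B = j \<and> B \<subseteq> A} < l" if "A \<in> ?U" "?rk A < j" for A j
    proof (cases "j \<le> dim UNIV")
      case True
      have "card {B\<in>?U. ?rk B = j \<and> B \<subseteq> A} \<le> card {B\<in>F. dim B = dim UNIV - j \<and> B \<subseteq> A}"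
        by (rule card_mono) (use dim_le_UNIV in \<open>auto simp del: dim_UNIV\<close>)
      also have "\<dots> < l" using below[of A "dim UNIV - j"] that True by auto
      finally show ?thesis .
    next
      case False
      then have "{B\<in>?U. ?rk B = j \<and> B \<subseteq> A} = {}" by auto
      \<comment> \<open>Any dimension other than that of A makes \<open>below\<close> bound a
        cardinality strictly by l.\<close>
      moreover have "0 < l" using below[of A "Suc (dim A)"] that by simp
      ultimately show ?thesis by (simp only: card.empty)
    qed
    have rk: "?rk A < m \<longleftrightarrow> m < dim A" "?rk A \<le> m \<longleftrightarrow> m \<le> dim A" "?rk A = m \<longleftrightarrow> dim A = m" for A
      using dim_le_UNIV[of A] unfolding dim by linarith+
    have W: "{A\<in>?U. ?rk A < m} = Whi" unfolding rk by (auto simp: Whi_def)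
    have G: "{B\<in>?X. ?rk B = m \<and> B \<notin> ?U \<and> (\<exists>A\<in>?U. ?rk A < m \<and> B \<subseteq> A)} = Ghi"
      unfolding Ghi_def W[symmetric] unfolding rk by (auto simp: M)
    show ?thesis
      using shadow_doubling[of ?U 0 l] few F \<open>l \<le> q\<close> unfolding W G by blast
  qed
  have F_split: "F = (F \<inter> M) \<union> (Wlo \<union> Whi)"
    using F by (auto simp: Wlo_def Whi_def M)
  have "card F = card (F \<inter> M) + card (Wlo \<union> Whi)"
    by (subst F_split, rule card_Un_disjoint) (auto simp: Wlo_def Whi_def M)
  also have "card (Wlo \<union> Whi) = card Wlo + card Whi"
    by (rule card_Un_disjoint) (auto simp: Wlo_def Whi_def)
  finally have cF: "card F = card (F \<inter> M) + (card Wlo + card Whi)" .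
  have "card M = card (M \<inter> F) + card (M - F)"
    by (rule card_Int_Diff) simp
  then have cM: "card M = card (F \<inter> M) + card (M - F)"
    by (simp only: Int_commute)
  have sub: "Glo \<subseteq> M - F" "Ghi \<subseteq> M - F" by (auto simp: Glo_def Ghi_def)
  have G_le: "card Glo \<le> card (M - F)" "card Ghi \<le> card (M - F)"
    by (rule card_mono; use sub in simp)+
  show "card F \<le> card M" using cF cM lo hi G_le by linarith
  show "F = M \<or> m = 1 \<and> k = q \<and> l = q" if eq: "card F = card M"
  proof (cases "Wlo = {} \<and> Whi = {}")
    case True
    then have "F \<subseteq> M" using F_split by blast
    then show ?thesis using eq card_subset_eq[of M F] by simp
  next
    case False
    \<comment> \<open>Equality makes \<open>card Wlo + card Whi\<close> equal to
      \<open>card (M - F)\<close>, while neither term exceeds half of it. Hence both are exactly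
      half, and if one is nonempty so is the other.\<close>
    have lo_eq: "card Glo = 2 * card Wlo" "card Glo = card (M - F)"
      and hi_eq: "card Ghi = 2 * card Whi" "card Ghi = card (M - F)"
      using cF cM lo hi G_le eq by linarith+
    have ne: "Wlo \<noteq> {}" "Whi \<noteq> {}" using False lo_eq hi_eq by auto
    then have kl: "k = q" "l = q" using lo hi lo_eq hi_eq by blast+
    have "Glo = M - F" "Ghi = M - F"
      using card_subset_eq[OF _ sub(1)] card_subset_eq[OF _ sub(2)] lo_eq(2) hi_eq(2) by simp_all
    moreover have "card Wlo \<noteq> 0" using ne(1) by simp
    then have "Glo \<noteq> {}" using lo_eq(1) by auto
    \<comment> \<open>\<open>Glo\<close> and \<open>Ghi\<close> both equal \<open>M - F\<close>, so
      a middle subspace B outside F lies above a member of \<open>Wlo\<close> and below a member of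
      \<open>Whi\<close>.\<close>
    ultimately obtain B where B: "B \<in> Glo" "B \<in> Ghi" "B \<in> M" by auto
    then obtain C where C: "C \<in> Whi" "B \<subseteq> C" by (auto simp: Ghi_def)
    have B: "B \<in> Glo" "subspace B" "dim B = m" using B by (auto simp: M subspaces_def)
    have "m \<noteq> 0" using ne(1) by (auto simp: Wlo_def)
    have "m = 1"
    proof (rule ccontr)
      assume "m \<noteq> 1"
      \<comment> \<open>By the equality clause of \<open>lo\<close> all hyperplanes of B belong to
        F. They lie below C, and for m \<ge> 2 there are at least [2] = q + 1 of them, too many for
        \<open>below\<close>.\<close>
      then have "q_bracket q (Suc (Suc 0)) \<le> q_bracket q m"
        using \<open>m \<noteq> 0\<close> by (intro q_bracket_mono) simp
      also have "q_bracket q m = card {A. subspace A \<and> A \<subseteq> B \<and> Suc (dim A) = dim B}"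
        using card_hyperplanes[OF B(2)] B(3) by simp
      also have "\<dots> \<le> card {A\<in>F. dim A = m - 1 \<and> A \<subseteq> C}"
      proof (rule card_mono)
        show "{A. subspace A \<and> A \<subseteq> B \<and> Suc (dim A) = dim B} \<subseteq> {A\<in>F. dim A = m - 1 \<and> A \<subseteq> C}"
          using lo lo_eq(1) B(1,3) C(2) by (auto simp: subspaces_def Wlo_def)
      qed simp
      also have "\<dots> < l" using below[of C "m - 1"] C(1) by (auto simp: Whi_def)
      finally show False using kl by (simp add: q_bracket_Suc)
    qed
    then show ?thesis using kl by simp
  qed
qed

text \<open>Inclusion within one level is equality, whereas both forbidden posets contain two
  distinct related elements because k and l are positive.\<close>

lemma induced_free_subspaces_of_dim:
  assumes "1 \<le> k" "1 \<le> l"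
  shows "induced_free_family scale {V_poset k, Lambda_poset l} (subspaces_of_dim scale d)"
proof -
  have eq: "A = B" if "(A, B) \<in> inclusion_order (subspaces_of_dim scale d)" for A B
    using that subspace_dim_equal[of A B]
    by (auto simp: inclusion_order_def subspaces_of_dim_def subspaces_def)
  have no: "\<not> induced_subposet P (inclusion_order (subspaces_of_dim scale d))"
    if "(x, y) \<in> P" "x \<noteq> y" for P :: "nat rel" and x y
    using that eq unfolding induced_subposet_def inj_on_def
    by (meson FieldI1 FieldI2)
  have "(0, 1) \<in> V_poset k" "(1, 0) \<in> Lambda_poset l"
    using assms by (auto simp: V_poset_def Lambda_poset_def)
  then show ?thesis
    using no[of 0 1] no[of 1 0] by (auto simp: induced_free_family_def subspaces_of_dim_def)
qed

end

section \<open>The extremal number and the uniqueness of the middle level\<close>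

theorem theorem6:
  fixes scale :: "'a::{field,finite} \<Rightarrow> 'b::ab_group_add \<Rightarrow> 'b"
    and Basis :: "'b set"
    and q n k l :: nat
  assumes "primepow q" and "card (UNIV :: 'a set) = q"
    and "finite_dimensional_vector_space scale Basis"
    and "vector_space.dim scale (UNIV :: 'b set) = n"
    and "even n"
    and "1 \<le> k" and "k \<le> q" and "1 \<le> l" and "l \<le> q"
  shows "real (La_star scale {V_poset k, Lambda_poset l}) = gauss_binomial q n (n div 2) \<and>
    max_induced_free_family scale {V_poset k, Lambda_poset l} (subspaces_of_dim scale (n div 2)) \<and>
    (\<not> (n = 2 \<and> k = q \<and> l = q) \<longrightarrow>
      (\<forall>\<F>. max_induced_free_family scale {V_poset k, Lambda_poset l} \<F> \<longrightarrow>
           \<F> = subspaces_of_dim scale (n div 2)))"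
proof -
  interpret finite_vector_space scale Basis q
    using assms(2,3) by (simp add: finite_vector_space_def finite_vector_space_axioms_def)
  let ?P = "{V_poset k, Lambda_poset l}" and ?M = "subspaces_of_dim scale (n div 2)"
  have dim: "dim UNIV = 2 * (n div 2)" using assms(4,5) by simp
  have M_free: "induced_free_family scale ?P ?M"
    using assms by (intro induced_free_subspaces_of_dim)
  have La: "La_star scale ?P = card ?M"
    unfolding La_star_def
  proof (rule Max_eqI)
    have "finite (Pow (UNIV :: 'b set set))" by (simp add: finite_space Finite_Set.finite_set)
    then have "finite {\<F>. induced_free_family scale ?P \<F>}" by (rule rev_finite_subset) blast
    then show "finite (card ` {\<F>. induced_free_family scale ?P \<F>})" by (rule finite_imageI)
    show "card ?M \<in> card ` {\<F>. induced_free_family scale ?P \<F>}" using M_free by blast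
    show "y \<le> card ?M" if "y \<in> card ` {\<F>. induced_free_family scale ?P \<F>}" for y
      using that induced_free_family_le_middle(1)[OF dim assms(7,9)] by blast
  qed
  have gauss: "real (card ?M) = gauss_binomial q n (n div 2)"
    using card_subspaces_of_dim assms(4) by simp
  have unique: "\<F> = ?M" if "max_induced_free_family scale ?P \<F>" "\<not> (n = 2 \<and> k = q \<and> l = q)" for \<F>
  proof -
    \<comment> \<open>Evenness excludes n = 3, so the exceptional case m = 1 is precisely n =
      2.\<close>
    have "n div 2 = 1 \<longleftrightarrow> n = 2" using assms(5) by auto
    then show ?thesis
      using induced_free_family_le_middle(2)[OF dim assms(7,9), of \<F>] that La
      unfolding max_induced_free_family_def by argo
  qed
  have max: "max_induced_free_family scale ?P ?M"
    unfolding max_induced_free_family_def La by (rule conjI[OF M_free refl])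
  show ?thesis
    unfolding La by (intro conjI impI allI gauss max unique)
qed

end
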